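(* Let $p$ be an odd prime. The cyclic index of the affine group $\mathrm{Aff}(1,p^2)$ is $$\begin{aligned}P_{\mathrm{Aff}(1,p^2)}(x_1,\dots,x_{p^2})=\frac{1}{p^2\varphi(p^2)}\Big[&x_1^{p^2}+(p-1)x_p^{p}+p^2\sum_{t\mid p-1,\ t\neq1}\varphi(t)\,x_1x_t^{\frac{p^2-1}{t}}\\&+p^2\sum_{t\mid p-1,\ t\neq1}\varphi(tp)\,x_1x_{tp}^{\frac{p-1}{t}}x_t^{\frac{p-1}{t}}+p(p-1)x_1^{p}x_p^{p-1}+p\,\varphi(p^2)\,x_{p^2}\Big],\end{aligned}$$ where $\varphi$ is Euler's phi-function and the sums run over the positive divisors $t\neq 1$ of $p-1$.
   Context: $\mathrm{Aff}(1,p^2)$ is the one-dimensional affine group of $\mathbb{Z}_{p^2}$ (the ring of integers modulo $p^2$), i.e. the group of permutations $y\mapsto\nu y+u$ of $\mathbb{Z}_{p^2}$ with $\nu$ a unit of $\mathbb{Z}_{p^2}$ and $u\in\mathbb{Z}_{p^2}$. For a permutation group $\mathcal{S}$ on a finite set with $k$ elements, its cyclic index (cycle index) is the polynomial $$P_{\mathcal{S}}(x_1,\dots,x_k)=\frac{1}{|\mathcal{S}|}\sum_{\tau\in\mathcal{S}}x_1^{c_1(\tau)}\cdots x_k^{c_k(\tau)}\in\mathbb{Q}[x_1,\dots,x_k],$$ where $c_l(\tau)$ is the number of $l$-cycles in the disjoint cycle decomposition of $\tau$ (fixed points counted as $1$-cycles). *)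

theory Defs
  imports
    "HOL-Number_Theory.Residues"
    "HOL-Combinatorics.Orbits"
    "HOL-Library.Poly_Mapping"
begin

text \<open>
  A monomial \<open>\<Prod>i. x\<^sub>i ^ e\<^sub>i\<close> is its finitely supported exponent vector \<open>e\<close>, and a polynomial
  maps monomials to coefficients; products in this type are products of polynomials. The
  indeterminates are indexed by all of \<open>nat\<close>, so \<open>\<rat>[x\<^sub>1, \<dots>, x\<^sub>k]\<close> is a subring for every \<open>k\<close>.
\<close>

type_synonym rat_mpoly = "(nat \<Rightarrow>\<^sub>0 nat) \<Rightarrow>\<^sub>0 rat"

definition var :: "nat \<Rightarrow> rat_mpoly" where
  "var i = Poly_Mapping.single (Poly_Mapping.single i 1) 1"

definition const :: "rat \<Rightarrow> rat_mpoly" where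
  "const c = Poly_Mapping.single 0 c"

text \<open>
  A cycle of the permutation \<open>\<tau>\<close> of \<open>X\<close> is identified with the set of points it moves cyclically;
  a fixed point \<open>a\<close> contributes the 1-cycle \<open>{a}\<close>.
\<close>

definition cycle_count :: "'a set \<Rightarrow> ('a \<Rightarrow> 'a) \<Rightarrow> nat \<Rightarrow> nat" where
  "cycle_count X \<tau> l = card {C. C \<subseteq> X \<and> cyclic_on \<tau> C \<and> card C = l}"

text \<open>
  Intended for a finite set \<open>X\<close> and a group \<open>S\<close> of permutations of \<open>X\<close>, each
  being the identity outside \<open>X\<close> (\<open>\<tau> permutes X\<close>), so that \<open>card S\<close> is the group order.
\<close>

definition cycle_index :: "'a set \<Rightarrow> ('a \<Rightarrow> 'a) set \<Rightarrow> rat_mpoly" where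
  "cycle_index X S =
     const (1 / of_nat (card S)) * (\<Sum>\<tau>\<in>S. \<Prod>l = 1..card X. var l ^ cycle_count X \<tau> l)"

definition affine_perm :: "('a, 'b) ring_scheme \<Rightarrow> 'a \<Rightarrow> 'a \<Rightarrow> 'a \<Rightarrow> 'a" where
  "affine_perm R \<nu> u = (\<lambda>y. if y \<in> carrier R then (\<nu> \<otimes>\<^bsub>R\<^esub> y) \<oplus>\<^bsub>R\<^esub> u else y)"

definition Aff1 :: "('a, 'b) ring_scheme \<Rightarrow> ('a \<Rightarrow> 'a) set" where
  "Aff1 R = {affine_perm R \<nu> u | \<nu> u. \<nu> \<in> Units R \<and> u \<in> carrier R}"

end

theory Submission
  imports Defs "HOL-Number_Theory.Residue_Primitive_Roots"
begin

text \<open>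
  The length of the cycle through \<open>y\<close> under \<open>f(y) = a y + u\<close> can be read off from a single
  identity. Put \<open>d = f(y) - y = (a - 1) y + u\<close>. Each step multiplies the displacement by \<open>a\<close>, so
  \<open>f\<^sup>k(y) - y = (1 + a + \<dots> + a\<^sup>k\<^sup>-\<^sup>1) d\<close>, and \<open>y\<close> returns after \<open>k\<close> steps iff \<open>p\<^sup>2\<close> divides this
  product (\<open>affine_perm_funpow_fixed_iff\<close>). Hence the cycle length depends only on whether \<open>d\<close>
  is divisible by \<open>p\<^sup>2\<close>, by \<open>p\<close> only, or not by \<open>p\<close>: it is \<open>1\<close>, \<open>m\<close> or \<open>m'\<close>, where the
  \<open>k\<close> for which \<open>p\<close>, respectively \<open>p\<^sup>2\<close>, divides the geometric sum are the multiples of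
  \<open>m\<close>, respectively \<open>m'\<close>. There are two regimes.

  \<^item> If \<open>a \<equiv> 1\<close> modulo \<open>p\<close>, then \<open>p\<close> odd gives \<open>m = p\<close> and \<open>m' = p\<^sup>2\<close>
    (\<open>prime_power_dvd_geometric_sum_iff\<close>). If \<open>p\<close> does not divide \<open>u\<close>, then it never divides
    \<open>d\<close>, and \<open>f\<close> is a single cycle. If \<open>p\<close> divides \<open>u\<close> and \<open>a = 1\<close>, then \<open>f\<close> is the identity
    or, for \<open>u \<noteq> 0\<close>, has \<open>p\<close> cycles of length \<open>p\<close>. If \<open>p\<close> divides \<open>u\<close> and \<open>a \<noteq> 1\<close>, then
    \<open>f\<close> has \<open>p\<close> fixed points and \<open>p - 1\<close> cycles of length \<open>p\<close>.
  \<^item> Otherwise \<open>a - 1\<close> is a unit, so the geometric sum may be replaced by \<open>a\<^sup>k - 1\<close>, and \<open>m\<close>,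
    \<open>m'\<close> are the orders of \<open>a\<close> modulo \<open>p\<close> and \<open>p\<^sup>2\<close>. As \<open>y\<close> varies, \<open>d\<close> runs through all
    residues, so there are one fixed point, \<open>p - 1\<close> points of period \<open>m\<close> and \<open>p\<^sup>2 - p\<close> of
    period \<open>m'\<close>.

  Summed over \<open>u\<close>, the cycle monomials therefore depend on \<open>a\<close> only through its order modulo \<open>p\<^sup>2\<close>.
  The unit group is
  cyclic of order \<open>p (p - 1)\<close>, so the possible orders are \<open>t\<close> and \<open>t p\<close> with \<open>t\<close> dividing
  \<open>p - 1\<close>, they occur \<open>\<phi>(t)\<close> and \<open>\<phi>(t p)\<close> times, and \<open>t\<close> is the order modulo \<open>p\<close> in both
  cases (\<open>sum_totatives_prime_square\<close>, \<open>ord_prime_eq_of_ord_prime_square\<close>). The two orders with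
  \<open>t = 1\<close> form the first regime; all others form the second and give the two sums.
\<close>

section \<open>Cycles and point periods\<close>

text \<open>
  The cycles of length \<open>l\<close> partition the points whose orbit has \<open>l\<close> elements, so cycles can be
  counted by counting points.
\<close>

lemma mult_cycle_count:
  assumes "finite X" "f permutes X"
  shows "l * cycle_count X f l = card {x \<in> X. card (orbit f x) = l}"
proof -
  let ?\<C> = "{C. C \<subseteq> X \<and> cyclic_on f C \<and> card C = l}"
  have orbit_eq: "orbit f x = C" if "cyclic_on f C" "x \<in> C" for x C
    using orbit_cyclic_eq3[OF that] .
  have union: "\<Union>?\<C> = {x \<in> X. card (orbit f x) = l}"
  proof (intro equalityI subsetI)
    fix x assume "x \<in> {x \<in> X. card (orbit f x) = l}"
    then have x: "x \<in> X" "card (orbit f x) = l" by auto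
    have "x \<in> orbit f x"
      using assms permutation_permutes by (intro permutation_self_in_orbit) blast
    moreover have "orbit f x \<in> ?\<C>"
      using x permutes_orbit_subset[OF assms(2) x(1)] cyclic_on_orbit[OF assms(2,1)] by auto
    ultimately show "x \<in> \<Union>?\<C>" by blast
  qed (use orbit_eq in auto)
  have "l * card ?\<C> = card (\<Union>?\<C>)"
  proof (rule card_partition)
    show "finite ?\<C>" using assms(1) by (auto intro: finite_subset[of _ "Pow X"])
    show "finite (\<Union>?\<C>)" using assms(1) by (auto intro: finite_subset[of _ X])
    show "C \<inter> D = {}" if "C \<in> ?\<C>" "D \<in> ?\<C>" "C \<noteq> D" for C D
      using that orbit_eq by blast
  qed auto
  then show ?thesis by (simp add: cycle_count_def union)
qed

definition cycle_monomial :: "'a set \<Rightarrow> ('a \<Rightarrow> 'a) \<Rightarrow> rat_mpoly" where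
  "cycle_monomial X f = (\<Prod>l = 1..card X. var l ^ cycle_count X f l)"

text \<open>
  The index set \<open>L\<close> only has to contain all orbit sizes; superfluous lengths contribute the
  factor \<open>1\<close>. This lets the cycle type be read off from point counts without splitting the
  product over all lengths.
\<close>

lemma cycle_monomial_eq:
  assumes fin: "finite X" and perm: "f permutes X"
    and L: "finite L" "0 \<notin> L" "\<And>x. x \<in> X \<Longrightarrow> card (orbit f x) \<in> L"
  shows "cycle_monomial X f =
    (\<Prod>l\<in>L. var l ^ (card {x \<in> X. card (orbit f x) = l} div l))"
proof -
  have count: "cycle_count X f l = card {x \<in> X. card (orbit f x) = l} div l" if "l > 0" for l
    using mult_cycle_count[OF fin perm, of l] that by (metis nonzero_mult_div_cancel_left not_gr0)
  have outside: "cycle_count X f l = 0" if l: "l > 0" "l \<notin> L \<or> l > card X" for l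
  proof -
    have "card (orbit f x) \<le> card X" if "x \<in> X" for x
      using permutes_orbit_subset[OF perm that] fin by (intro card_mono)
    then have "{x \<in> X. card (orbit f x) = l} = {}"
      using l L(3) by fastforce
    then show ?thesis using count[OF l(1)] by (simp only: card.empty) simp
  qed
  have L_pos: "l > 0" if "l \<in> L" for l
    using L(2) that by (metis gr0I)
  have "(\<Prod>l = 1..card X. var l ^ cycle_count X f l) =
      (\<Prod>l\<in>{1..card X} \<union> L. var l ^ cycle_count X f l)"
    using L(1) L_pos outside by (intro prod.mono_neutral_left) (auto simp: Suc_le_eq)
  also have "\<dots> = (\<Prod>l\<in>L. var l ^ cycle_count X f l)"
    using L(1) outside by (intro prod.mono_neutral_right) auto
  also have "\<dots> = (\<Prod>l\<in>L. var l ^ (card {x \<in> X. card (orbit f x) = l} div l))"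
    using L_pos count by (intro prod.cong) auto
  finally show ?thesis unfolding cycle_monomial_def .
qed

lemma card_orbit_eqI:
  assumes "m > 0" and period: "\<And>k. (f ^^ k) x = x \<longleftrightarrow> m dvd k"
  shows "card (orbit f x) = m"
proof -
  have no_repeat: "(f ^^ i) x \<noteq> (f ^^ j) x" if "i < j" "j < m" for i j
  proof
    assume "(f ^^ i) x = (f ^^ j) x"
    then have "(f ^^ (m - j)) ((f ^^ i) x) = (f ^^ (m - j)) ((f ^^ j) x)" by simp
    also have "\<dots> = (f ^^ m) x"
      using that funpow_add[of "m - j" j f] by (simp add: fun_eq_iff)
    also have "\<dots> = x" using period by simp
    finally have "(f ^^ (m - j + i)) x = x" by (simp add: funpow_add)
    then have "m dvd m - j + i" using period by blast
    with that show False by (auto dest!: dvd_imp_le)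
  qed
  then have "inj_on (\<lambda>i. (f ^^ i) x) {..<m}"
    by (intro linorder_inj_onI') auto
  moreover have "orbit f x = (\<lambda>i. (f ^^ i) x) ` {..<m}"
    using orbit_altdef_bounded[of m f x] assms by auto
  ultimately show ?thesis by (simp add: card_image)
qed

section \<open>Affine permutations of residue rings\<close>

lemma affine_perm_residue_ring:
  assumes "n > 1" "y \<in> {0..<int n}"
  shows "affine_perm (residue_ring (int n)) a u y = (a * y + u) mod int n"
  using assms by (simp add: affine_perm_def residue_ring_def mod_add_left_eq)

lemma affine_perm_permutes:
  assumes n: "n > 1" and "coprime a (int n)"
  shows "affine_perm (residue_ring (int n)) a u permutes {0..<int n}" (is "?f permutes ?X")
proof (rule inj_imp_permutes)
  show "inj_on ?f ?X"
  proof (rule inj_onI)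
    fix y z assume yz: "y \<in> ?X" "z \<in> ?X" and "?f y = ?f z"
    then have "[a * y + u = a * z + u] (mod int n)"
      using n by (simp add: affine_perm_residue_ring cong_def)
    then have "[y = z] (mod int n)"
      using assms(2) by (metis cong_add_rcancel cong_mult_lcancel)
    then show "y = z" using yz by (simp add: cong_def)
  qed
  show "?f y \<in> ?X" if "y \<in> ?X" for y
    using n that by (simp add: affine_perm_residue_ring)
  show "?f y = y" if "y \<notin> ?X" for y
    using that by (auto simp: affine_perm_def residue_ring_def)
qed auto

text \<open>
  The displacement satisfies \<open>f(z) - z = (a - 1) z + u\<close>, and applying \<open>f\<close> multiplies it by \<open>a\<close>;
  summing the displacements of the first \<open>k\<close> steps gives a geometric sum. Keeping the sum
  undivided by \<open>a - 1\<close> covers all multipliers at once, including those with \<open>a - 1\<close> not invertible.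
\<close>

lemma affine_perm_funpow_fixed_iff:
  assumes n: "n > 1" and y: "y \<in> {0..<int n}"
  shows "(affine_perm (residue_ring (int n)) a u ^^ k) y = y \<longleftrightarrow>
    int n dvd (\<Sum>i<k. a ^ i) * ((a - 1) * y + u)"
proof -
  let ?f = "affine_perm (residue_ring (int n)) a u"
  have "(?f ^^ k) y \<in> {0..<int n} \<and>
      [(?f ^^ k) y = y + (\<Sum>i<k. a ^ i) * ((a - 1) * y + u)] (mod int n)"
  proof (induction k)
    case 0
    then show ?case using y by simp
  next
    case (Suc k)
    let ?z = "(?f ^^ k) y" and ?S = "\<Sum>i<k. a ^ i" and ?d = "(a - 1) * y + u"
    have "[?f ?z = a * ?z + u] (mod int n)"
      using n Suc by (simp add: affine_perm_residue_ring)
    also have "[a * ?z + u = a * (y + ?S * ?d) + u] (mod int n)"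
      using Suc by (intro cong_add cong_mult) auto
    also have "a * (y + ?S * ?d) + u = y + (1 + a * ?S) * ?d"
      by (simp add: algebra_simps)
    also have "1 + a * ?S = (\<Sum>i<Suc k. a ^ i)"
      by (simp add: sum.lessThan_Suc_shift sum_distrib_left del: sum.lessThan_Suc)
    finally show ?case
      using n Suc by (simp add: affine_perm_residue_ring)
  qed
  then have range: "(?f ^^ k) y \<in> {0..<int n}"
    and iterate: "[(?f ^^ k) y = y + (\<Sum>i<k. a ^ i) * ((a - 1) * y + u)] (mod int n)"
    by auto
  have "(?f ^^ k) y = y \<longleftrightarrow> [(?f ^^ k) y = y] (mod int n)"
    using range y by (auto simp: cong_def)
  also have "\<dots> \<longleftrightarrow> [y + (\<Sum>i<k. a ^ i) * ((a - 1) * y + u) = y] (mod int n)"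
    using iterate cong_sym cong_trans by blast
  also have "\<dots> \<longleftrightarrow> int n dvd (\<Sum>i<k. a ^ i) * ((a - 1) * y + u)"
    by (simp add: cong_iff_dvd_diff)
  finally show ?thesis .
qed

text \<open>
  Multiplier and translation part are determined by the map, through its values at \<open>0\<close> and \<open>1\<close>,
  so the sum over the group has no repetitions.
\<close>

lemma sum_Aff1_residue_ring:
  fixes F :: "(int \<Rightarrow> int) \<Rightarrow> 'b :: comm_monoid_add"
  assumes n: "n > 1"
  defines "R \<equiv> residue_ring (int n)"
  shows "(\<Sum>f\<in>Aff1 R. F f) =
    (\<Sum>a\<in>totatives n. \<Sum>u\<in>{0..<int n}. F (affine_perm R (int a) u))"
proof -
  interpret residues "int n" R
    using n by unfold_locales (auto simp: R_def)
  have carrier: "carrier R = {0..<int n}" by (auto simp: res_carrier_eq)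
  have units: "Units R = int ` totatives n"
  proof (intro equalityI subsetI)
    fix x assume "x \<in> Units R"
    then have "0 < x" "x < int n" "coprime x (int n)" by (auto simp: res_units_eq)
    moreover from this obtain b where "x = int b" using nonneg_int_cases[of x] by auto
    ultimately show "x \<in> int ` totatives n" by (auto simp: totatives_def)
  qed (use n totatives_less[OF _ n] in \<open>auto simp: res_units_eq totatives_def\<close>)
  have inj: "inj_on (\<lambda>(a, u). affine_perm R (int a) u) (totatives n \<times> {0..<int n})"
  proof (rule inj_onI, clarify)
    fix a u b v
    assume ab: "a \<in> totatives n" "b \<in> totatives n" and uv: "u \<in> {0..<int n}" "v \<in> {0..<int n}"
      and eq: "affine_perm R (int a) u = affine_perm R (int b) v"
    have "(int a * y + u) mod int n = (int b * y + v) mod int n" if "y \<in> {0..<int n}" for y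
      using affine_perm_residue_ring[OF n that] eq by (metis R_def)
    from this[of 0] this[of 1] n uv have "u = v" "[int a + u = int b + v] (mod int n)"
      by (auto simp: cong_def)
    then have "[a = b] (mod n)" by (simp add: cong_add_rcancel cong_int_iff)
    then have "a = b" using totatives_less[OF _ n] ab by (auto simp: cong_def)
    then show "a = b \<and> u = v" using \<open>u = v\<close> by simp
  qed
  have "Aff1 R = (\<lambda>(a, u). affine_perm R (int a) u) ` (totatives n \<times> {0..<int n})"
    unfolding Aff1_def carrier units by (auto, blast)
  then have "(\<Sum>f\<in>Aff1 R. F f) =
      sum (F \<circ> (\<lambda>(a, u). affine_perm R (int a) u)) (totatives n \<times> {0..<int n})"
    by (simp only: sum.reindex[OF inj])
  then show ?thesis by (simp add: sum.cartesian_product case_prod_unfold)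
qed

text \<open>
  For invertible \<open>a\<close> the condition fixes one residue class of \<open>y\<close> modulo \<open>m\<close>, which meets every
  block of \<open>m\<close> consecutive integers once.
\<close>

lemma card_linear_dvd:
  fixes a u :: int
  assumes "coprime a (int m)" "m > 0"
  shows "card {y \<in> {0..<int (m * k)}. int m dvd a * y + u} = k"
proof -
  obtain b where b: "[a * b = 1] (mod int m)"
    using assms(1) cong_solve_coprime_int by blast
  define r where "r = (- u * b) mod int m"
  have r: "0 \<le> r" "r < int m" using assms(2) by (auto simp: r_def)
  have "[a * r = a * (- u * b)] (mod int m)"
    by (intro cong_mult) (auto simp: r_def)
  also have "a * (- u * b) = - u * (a * b)" by simp
  also have "[- u * (a * b) = - u * 1] (mod int m)" using b by (intro cong_mult) auto
  finally have ar: "[a * r = - u] (mod int m)" by simp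
  have "int m dvd a * y + u \<longleftrightarrow> y mod int m = r" for y
  proof -
    have "int m dvd a * y + u \<longleftrightarrow> [a * y = - u] (mod int m)"
      by (simp add: cong_iff_dvd_diff)
    also have "\<dots> \<longleftrightarrow> [a * y = a * r] (mod int m)"
      using ar cong_sym cong_trans by blast
    also have "\<dots> \<longleftrightarrow> [y = r] (mod int m)"
      using assms(1) by (simp add: cong_mult_lcancel)
    finally show ?thesis using r by (simp add: cong_def)
  qed
  moreover have "{y \<in> {0..<int (m * k)}. y mod int m = r} = (\<lambda>i. int m * int i + r) ` {..<k}"
  proof (intro equalityI subsetI)
    fix y assume y: "y \<in> {y \<in> {0..<int (m * k)}. y mod int m = r}"
    then have split: "y = int m * (y div int m) + r"
      by (metis (mono_tags) mem_Collect_eq mult_div_mod_eq)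
    have "0 \<le> y div int m" using y assms(2) by (auto simp: pos_imp_zdiv_nonneg_iff)
    moreover have "int m * (y div int m) < int m * int k"
    proof -
      have "y < int m * int k" using y by simp
      then show ?thesis using split r by linarith
    qed
    then have "y div int m < int k" using assms(2) by simp
    ultimately show "y \<in> (\<lambda>i. int m * int i + r) ` {..<k}"
      using split by (intro image_eqI[of _ _ "nat (y div int m)"]) auto
  next
    fix y assume "y \<in> (\<lambda>i. int m * int i + r) ` {..<k}"
    then obtain i where i: "i < k" "y = int m * int i + r" by auto
    have "int m * (int i + 1) \<le> int m * int k"
      using i(1) by (intro mult_left_mono) auto
    then show "y \<in> {y \<in> {0..<int (m * k)}. y mod int m = r}"
      using i r by (auto simp: distrib_left)
  qed
  moreover have "inj_on (\<lambda>i. int m * int i + r) {..<k}"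
    using assms(2) by (auto intro: inj_onI)
  ultimately show ?thesis by (simp add: card_image)
qed

section \<open>Geometric sums modulo powers of a prime\<close>

lemma power_one_plus_multiple_cong:
  fixes m c :: int
  shows "[(1 + m * c) ^ k = 1 + int k * (m * c)] (mod m\<^sup>2)"
proof (induction k)
  case (Suc k)
  have "[(1 + m * c) ^ Suc k = (1 + m * c) * (1 + int k * (m * c))] (mod m\<^sup>2)"
    using Suc by (auto intro: cong_mult)
  also have "(1 + m * c) * (1 + int k * (m * c)) =
      1 + int (Suc k) * (m * c) + m\<^sup>2 * (int k * c\<^sup>2)"
    by (simp add: algebra_simps power2_eq_square)
  also have "[\<dots> = 1 + int (Suc k) * (m * c)] (mod m\<^sup>2)"
    by (simp add: cong_iff_dvd_diff)
  finally show ?case .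
qed simp

text \<open>
  Writing \<open>a = 1 + p c\<close> and expanding to first order, which is exact modulo \<open>p\<^sup>2\<close>, twice the
  geometric sum becomes \<open>k (2 + p c (k - 1))\<close>. As \<open>p\<close> is odd, both the \<open>2\<close> on the left and the
  second factor on the right are prime to \<open>p\<close>. The bound on \<open>j\<close> reflects this precision.
\<close>

lemma prime_power_dvd_geometric_sum_iff:
  fixes a :: int
  assumes p: "prime p" "odd p" and a: "[a = 1] (mod int p)" and j: "j \<le> 2"
  shows "int (p ^ j) dvd (\<Sum>i<k. a ^ i) \<longleftrightarrow> p ^ j dvd k"
proof -
  obtain c where c: "a = 1 + int p * c"
    using a by (metis cong_iff_lin cong_sym)
  define e where "e = 2 + int p * c * (int k - 1)"
  have sum_eq: "[2 * (\<Sum>i<k. a ^ i) = int k * (2 + int p * c * (int k - 1))] (mod (int p)\<^sup>2)"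
  proof (induction k)
    case (Suc k)
    have "2 * (\<Sum>i<Suc k. a ^ i) = 2 * (\<Sum>i<k. a ^ i) + 2 * a ^ k" by simp
    also have "[\<dots> = int k * (2 + int p * c * (int k - 1)) + 2 * (1 + int k * (int p * c))]
        (mod (int p)\<^sup>2)"
      unfolding c
      by (rule cong_add[OF Suc[unfolded c] cong_mult[OF cong_refl power_one_plus_multiple_cong]])
    also have "int k * (2 + int p * c * (int k - 1)) + 2 * (1 + int k * (int p * c)) =
        int (Suc k) * (2 + int p * c * (int (Suc k) - 1))"
      by (simp add: algebra_simps)
    finally show ?case .
  qed simp
  have two: "coprime (int p ^ j) 2"
    using p(2) by simp
  have "coprime (int p) e"
  proof -
    have "coprime (int p) 2" using p(2) by simp
    moreover have "gcd (int p) e = gcd (int p) 2"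
      unfolding e_def by (metis gcd_add_mult mult.assoc mult.commute add.commute)
    ultimately show ?thesis by (simp add: coprime_iff_gcd_eq_1)
  qed
  then have e: "coprime (int p ^ j) e" by simp
  have "int p ^ j dvd (\<Sum>i<k. a ^ i) \<longleftrightarrow> int p ^ j dvd 2 * (\<Sum>i<k. a ^ i)"
    using two by (simp add: coprime_dvd_mult_right_iff)
  also have "\<dots> \<longleftrightarrow> int p ^ j dvd int k * e"
    unfolding e_def by (rule cong_dvd_iff[OF cong_dvd_modulus[OF sum_eq le_imp_power_dvd[OF j]]])
  also have "\<dots> \<longleftrightarrow> int p ^ j dvd int k"
    using e by (simp add: coprime_dvd_mult_left_iff)
  finally show ?thesis by (metis of_nat_dvd_iff of_nat_power)
qed

text \<open>
  Here \<open>a - 1\<close> is a unit modulo \<open>p\<^sup>j\<close>, and multiplying the geometric sum by it gives \<open>a\<^sup>k - 1\<close>.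
\<close>

lemma prime_power_dvd_geometric_sum_iff_ord:
  fixes a p :: nat
  assumes p: "prime p" and a: "\<not> [a = 1] (mod p)"
  shows "int (p ^ j) dvd (\<Sum>i<k. int a ^ i) \<longleftrightarrow> ord (p ^ j) a dvd k"
proof -
  have "\<not> int p dvd int a - 1"
    using a by (metis cong_iff_dvd_diff cong_int_iff of_nat_1)
  then have "coprime (int (p ^ j)) (int a - 1)"
    using p by (simp add: prime_imp_coprime)
  then have "int (p ^ j) dvd (\<Sum>i<k. int a ^ i) \<longleftrightarrow>
      int (p ^ j) dvd (int a - 1) * (\<Sum>i<k. int a ^ i)"
    by (simp only: coprime_dvd_mult_right_iff)
  also have "\<dots> \<longleftrightarrow> [a ^ k = 1] (mod p ^ j)"
    unfolding power_diff_1_eq[symmetric]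
    by (metis cong_iff_dvd_diff cong_int_iff of_nat_1 of_nat_power)
  finally show ?thesis by (simp only: ord_divides)
qed

section \<open>Units modulo the square of an odd prime\<close>

text \<open>
  In terms of a generator \<open>g\<close>, the power \<open>g\<^sup>i\<close> has order \<open>d\<close> iff \<open>gcd i \<phi>(n) = \<phi>(n) / d\<close>, so
  the elements of order \<open>d\<close> correspond to exponents with a prescribed gcd.
\<close>

lemma card_totatives_ord_eq:
  assumes "\<exists>g. residue_primroot n g" "n > 1" "d dvd totient n"
  shows "card {a \<in> totatives n. ord n a = d} = totient d"
proof -
  obtain g where g: "residue_primroot n g" using assms(1) by blast
  let ?N = "totient n"
  have N: "?N > 0" using assms(2) by simp
  have bij: "bij_betw (\<lambda>i. g ^ i mod n) {..<?N} (totatives n)"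
    using residue_primroot_is_generator[OF assms(2) g] .
  have ord: "ord n (g ^ i mod n) = ?N div gcd i ?N" for i
    using g by (simp add: ord_power residue_primroot_def)
  have gcd_iff: "?N div gcd i ?N = d \<longleftrightarrow> gcd i ?N = ?N div d" for i
    using assms(3) N
    by (metis div_div_eq_right dvd_div_eq_0_iff dvd_div_mult_self gcd_dvd2
        nonzero_mult_div_cancel_left not_gr0)
  have "{a \<in> totatives n. ord n a = d} =
      (\<lambda>i. g ^ i mod n) ` {i \<in> {..<?N}. gcd i ?N = ?N div d}"
    unfolding bij_betw_imp_surj_on[OF bij, symmetric] Compr_image_eq by (simp only: ord gcd_iff)
  moreover have "inj_on (\<lambda>i. g ^ i mod n) {i \<in> {..<?N}. gcd i ?N = ?N div d}"
    using bij_betw_imp_inj_on[OF bij] by (rule inj_on_subset) auto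
  ultimately have "card {a \<in> totatives n. ord n a = d} =
      card {i \<in> {..<?N}. gcd i ?N = ?N div d}"
    by (simp only: card_image)
  \<comment> \<open>The exponent \<open>0\<close> is traded for \<open>\<phi>(n)\<close>, which has the same gcd with \<open>\<phi>(n)\<close>.\<close>
  also have "\<dots> = card {i \<in> {0<..?N}. gcd i ?N = ?N div d}"
    by (rule bij_betw_same_card[of "\<lambda>i. if i = 0 then ?N else i"],
        rule bij_betw_byWitness[of _ "\<lambda>i. if i = ?N then 0 else i"]) (use N in auto)
  also have "\<dots> = totient (?N div (?N div d))"
    using N assms(3) by (intro card_gcd_eq_totient) auto
  also have "?N div (?N div d) = d"
    using N assms(3) by (metis div_div_eq_right dvd_refl div_self mult_1 not_gr0)
  finally show ?thesis .
qed

text \<open>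
  Raising to the \<open>p\<close>-th power links the two moduli: \<open>x \<equiv> 1\<close> modulo \<open>p\<close> implies \<open>x\<^sup>p \<equiv> 1\<close> modulo
  \<open>p\<^sup>2\<close>, and conversely \<open>x\<^sup>p \<equiv> x\<close> modulo \<open>p\<close> by Fermat. So \<open>a\<^sup>k \<equiv> 1\<close> modulo \<open>p\<close> iff
  \<open>a\<^sup>k\<^sup>p \<equiv> 1\<close> modulo \<open>p\<^sup>2\<close>, and since \<open>t\<close> is prime to \<open>p\<close> this says that \<open>t\<close> divides \<open>k\<close>.
\<close>

lemma ord_prime_eq_of_ord_prime_square:
  fixes a p t :: nat
  assumes p: "prime p" and t: "t dvd p - 1" and ord: "ord (p\<^sup>2) a = t \<or> ord (p\<^sup>2) a = t * p"
  shows "ord p a = t"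
proof -
  have "p > 1" using p prime_gt_1_nat by blast
  have "t > 0" using t \<open>p > 1\<close> by (auto intro!: gr0I)
  then have "ord (p\<^sup>2) a > 0" using ord \<open>p > 1\<close> by (auto simp del: ord_gt_0_iff)
  then have coprime: "coprime p a" by simp
  have "t < p" using t \<open>p > 1\<close> by (auto dest!: dvd_imp_le)
  then have tp: "coprime t p" using p \<open>t > 0\<close> by (metis coprime_commute nat_dvd_not_less prime_imp_coprime)
  have "ord p a dvd k \<longleftrightarrow> t dvd k" for k
  proof
    assume "ord p a dvd k"
    then have "[a ^ k = 1] (mod p)" by (simp only: ord_divides)
    then have "[int a ^ k = 1] (mod int p)" by (metis cong_int_iff of_nat_1 of_nat_power)
    then obtain c where "int a ^ k = 1 + int p * c"
      by (metis cong_iff_lin cong_sym)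
    then have "[int a ^ (k * p) = 1 + int p * (int p * c)] (mod (int p)\<^sup>2)"
      using power_one_plus_multiple_cong[of "int p" c p] by (simp add: power_mult)
    also have "[1 + int p * (int p * c) = 1] (mod (int p)\<^sup>2)"
      by (simp add: cong_iff_dvd_diff power2_eq_square)
    finally have "[a ^ (k * p) = 1] (mod p\<^sup>2)"
      by (metis cong_int_iff of_nat_1 of_nat_power)
    then have "ord (p\<^sup>2) a dvd k * p" by (simp only: ord_divides)
    then have "t dvd k * p" using ord by (auto dest: dvd_mult_left)
    then show "t dvd k" using tp by (simp add: coprime_dvd_mult_left_iff)
  next
    assume "t dvd k"
    then have "ord (p\<^sup>2) a dvd k * p" using ord by (auto intro: mult_dvd_mono)
    then have "[a ^ (k * p) = 1] (mod p\<^sup>2)" by (simp only: ord_divides)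
    then have pow_p: "[(a ^ k) ^ p = 1] (mod p)"
      by (metis cong_dvd_modulus_nat dvd_triv_left power2_eq_square power_mult)
    have "\<not> p dvd a ^ k"
      using p coprime by (metis coprime_absorb_left not_prime_unit prime_dvd_power)
    then have "[(a ^ k) ^ (p - 1) = 1] (mod p)"
      using p by (intro fermat_theorem)
    then have "[(a ^ k) ^ (p - 1) * a ^ k = 1 * a ^ k] (mod p)" by (intro cong_mult) auto
    then have "[(a ^ k) ^ p = a ^ k] (mod p)"
      using \<open>p > 1\<close> by (metis mult.commute mult_1 power_eq_if not_one_less_zero)
    then have "[a ^ k = 1] (mod p)" using pow_p cong_sym cong_trans by blast
    then show "ord p a dvd k" by (simp only: ord_divides)
  qed
  then show ?thesis by (meson dvd_antisym dvd_refl)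
qed

lemma divisors_prime_times_coprime:
  fixes p m :: nat
  assumes "prime p" "coprime p m"
  shows "{d. d dvd m * p} = {d. d dvd m} \<union> (\<lambda>t. t * p) ` {t. t dvd m}"
proof (intro equalityI subsetI)
  fix d assume "d \<in> {d. d dvd m * p}"
  then have d: "d dvd m * p" by simp
  show "d \<in> {d. d dvd m} \<union> (\<lambda>t. t * p) ` {t. t dvd m}"
  proof (cases "p dvd d")
    case True
    then obtain t where "d = t * p" by (metis dvdE mult.commute)
    then show ?thesis using d assms(1) by (auto simp: prime_gt_0_nat)
  next
    case False
    then have "coprime d p" using assms(1) by (metis coprime_commute prime_imp_coprime)
    then show ?thesis using d by (simp add: coprime_dvd_mult_left_iff)
  qed
qed auto

text \<open>
  The units are grouped by their order modulo \<open>p\<^sup>2\<close>, which is a divisor of \<open>(p - 1) p\<close> and hence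
  of the form \<open>t\<close> or \<open>t p\<close>; each order \<open>d\<close> is attained \<open>\<phi>(d)\<close> times because \<open>p\<^sup>2\<close> has a
  primitive root.
\<close>

lemma sum_totatives_prime_square:
  fixes H :: "nat \<Rightarrow> 'b :: comm_semiring_1"
  assumes p: "prime p" "odd p"
    and H1: "\<And>a t. a \<in> totatives (p\<^sup>2) \<Longrightarrow> t dvd p - 1 \<Longrightarrow> ord (p\<^sup>2) a = t \<Longrightarrow> H a = H1 t"
    and H2: "\<And>a t. a \<in> totatives (p\<^sup>2) \<Longrightarrow> t dvd p - 1 \<Longrightarrow> ord (p\<^sup>2) a = t * p \<Longrightarrow> H a = H2 t"
  shows "(\<Sum>a\<in>totatives (p\<^sup>2). H a) = (\<Sum>t | t dvd p - 1. of_nat (totient t) * H1 t) +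
    (\<Sum>t | t dvd p - 1. of_nat (totient (t * p)) * H2 t)"
proof -
  have p1: "p > 1" using p prime_gt_1_nat by blast
  have "\<exists>g. residue_primroot (p\<^sup>2) g"
    using residue_primroot_odd_prime_power_exists[OF p] by (metis pos2)
  moreover have p2: "p\<^sup>2 > 1" using p1 by (intro one_less_power) auto
  moreover have tot: "totient (p\<^sup>2) = (p - 1) * p"
    using totient_prime_power[of p 2] p(1) by simp
  ultimately have count: "card {a \<in> totatives (p\<^sup>2). ord (p\<^sup>2) a = d} = totient d"
    if "d dvd (p - 1) * p" for d
    using card_totatives_ord_eq that by metis
  have cop: "coprime p (p - 1)" using p1 by (intro coprime_diff_one_right_nat) simp
  have fin: "finite {t. t dvd p - 1}" using p1 by simp
  have fin': "finite {t. t dvd (p - 1) * p}" using p1 by simp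
  have disj: "{d. d dvd p - 1} \<inter> (\<lambda>t. t * p) ` {t. t dvd p - 1} = {}"
    using cop p1 by (auto dest!: dvd_mult_right simp: coprime_absorb_left)
  have inner: "(\<Sum>a | a \<in> totatives (p\<^sup>2) \<and> ord (p\<^sup>2) a = d. H a) = of_nat (totient d) * h"
    if "d dvd (p - 1) * p" "\<And>a. a \<in> totatives (p\<^sup>2) \<Longrightarrow> ord (p\<^sup>2) a = d \<Longrightarrow> H a = h" for d h
    using that count by simp
  have "(\<Sum>a\<in>totatives (p\<^sup>2). H a) =
      (\<Sum>d | d dvd (p - 1) * p. \<Sum>a | a \<in> totatives (p\<^sup>2) \<and> ord (p\<^sup>2) a = d. H a)"
    using order_divides_totient[of "p\<^sup>2"] tot fin'
    by (intro sum.group[symmetric]) (auto simp: totatives_def coprime_commute)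
  also have "\<dots> =
      (\<Sum>d | d dvd p - 1. \<Sum>a | a \<in> totatives (p\<^sup>2) \<and> ord (p\<^sup>2) a = d. H a) +
      (\<Sum>d\<in>(\<lambda>t. t * p) ` {t. t dvd p - 1}. \<Sum>a | a \<in> totatives (p\<^sup>2) \<and> ord (p\<^sup>2) a = d. H a)"
    unfolding divisors_prime_times_coprime[OF p(1) cop] using fin disj
    by (intro sum.union_disjoint) auto
  also have "(\<Sum>d\<in>(\<lambda>t. t * p) ` {t. t dvd p - 1}.
        \<Sum>a | a \<in> totatives (p\<^sup>2) \<and> ord (p\<^sup>2) a = d. H a) =
      (\<Sum>t | t dvd p - 1. \<Sum>a | a \<in> totatives (p\<^sup>2) \<and> ord (p\<^sup>2) a = t * p. H a)"
    using p1 by (intro sum.reindex[unfolded comp_def]) (auto simp: inj_on_def)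
  also have "\<dots> = (\<Sum>t | t dvd p - 1. of_nat (totient (t * p)) * H2 t)"
    by (intro sum.cong refl inner H2) auto
  also have "(\<Sum>t | t dvd p - 1. \<Sum>a | a \<in> totatives (p\<^sup>2) \<and> ord (p\<^sup>2) a = t. H a) =
      (\<Sum>t | t dvd p - 1. of_nat (totient t) * H1 t)"
    by (intro sum.cong refl inner H1) auto
  finally show ?thesis .
qed

section \<open>Cycle types of affine permutations modulo the square of an odd prime\<close>

context
  fixes p :: nat
  assumes p: "prime p" "odd p"
begin

abbreviation Z where "Z \<equiv> {0..<int (p\<^sup>2)}"

abbreviation aff where "aff \<equiv> affine_perm (residue_ring (int (p\<^sup>2)))"

lemma prime_square_gt_1: "p\<^sup>2 > 1"
  using p(1) prime_gt_1_nat by (intro one_less_power) auto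

lemma card_Z: "card Z = p\<^sup>2"
  by (simp del: of_nat_power)

lemma finite_Z_Collect: "finite {y \<in> Z. P y}"
  by (rule finite_subset[of _ Z]) auto

lemma card_Z_Diff: "card (Z - {y \<in> Z. P y}) = p\<^sup>2 - card {y \<in> Z. P y}"
proof -
  have "card (Z - {y \<in> Z. P y}) = card Z - card {y \<in> Z. P y}"
    by (rule card_Diff_subset[OF finite_Z_Collect]) blast
  then show ?thesis by (simp only: card_Z)
qed

text \<open>
  Whatever power of \<open>p\<close> divides the displacement \<open>(a - 1) y + u\<close> is cancelled from the
  requirement that \<open>p\<^sup>2\<close> divide its product with the geometric sum.
\<close>

lemma card_orbit_aff:
  assumes y: "y \<in> Z" and m: "m > 0" "m' > 0"
    and period: "\<And>k. int p dvd (\<Sum>i<k. a ^ i) \<longleftrightarrow> m dvd k"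
      "\<And>k. int (p\<^sup>2) dvd (\<Sum>i<k. a ^ i) \<longleftrightarrow> m' dvd k"
  shows "card (orbit (aff a u) y) =
    (if int (p\<^sup>2) dvd (a - 1) * y + u then 1
     else if int p dvd (a - 1) * y + u then m else m')"
proof (rule card_orbit_eqI)
  let ?d = "(a - 1) * y + u"
  fix k
  let ?S = "\<Sum>i<k. a ^ i"
  have p': "prime (int p)" "int p \<noteq> 0" using p(1) by auto
  have "int (p\<^sup>2) dvd ?S * ?d \<longleftrightarrow>
      (if int (p\<^sup>2) dvd ?d then 1 else if int p dvd ?d then m else m') dvd k"
  proof (cases "int p dvd ?d")
    case True
    then obtain e where e: "?d = int p * e" by blast
    show ?thesis
    proof (cases "int p dvd e")
      case True
      then have "int (p\<^sup>2) dvd ?d" unfolding e by (simp add: power2_eq_square)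
      then show ?thesis by simp
    next
      case False
      then have "\<not> int (p\<^sup>2) dvd ?d" unfolding e using p' by (simp add: power2_eq_square)
      moreover have "int (p\<^sup>2) dvd ?S * ?d \<longleftrightarrow> int p dvd ?S * e"
        unfolding e using p' by (simp add: power2_eq_square mult.left_commute)
      moreover have "\<dots> \<longleftrightarrow> int p dvd ?S"
        using False p' by (simp add: prime_dvd_mult_iff)
      ultimately show ?thesis using True period(1) by simp
    qed
  next
    case False
    then have "\<not> int (p\<^sup>2) dvd ?d"
      by (metis dvd_mult_left of_nat_mult power2_eq_square)
    moreover have "coprime (int (p\<^sup>2)) ?d"
      using False p' by (simp add: prime_imp_coprime)
    then have "int (p\<^sup>2) dvd ?S * ?d \<longleftrightarrow> int (p\<^sup>2) dvd ?S"
      by (rule coprime_dvd_mult_left_iff)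
    ultimately show ?thesis using False period(2) by simp
  qed
  then show "(aff a u ^^ k) y = y \<longleftrightarrow>
      (if int (p\<^sup>2) dvd ?d then 1 else if int p dvd ?d then m else m') dvd k"
    using affine_perm_funpow_fixed_iff[OF prime_square_gt_1 y] by simp
qed (use m in auto)

text \<open>
  The points fall into three classes according to their displacement: \<open>n0\<close> fixed points,
  \<open>n1 - n0\<close> points of period \<open>m\<close>, and \<open>p\<^sup>2 - n1\<close> points of period \<open>m'\<close>. When the two periods
  coincide the last two classes have to be merged before dividing by the period.
\<close>

lemma cycle_monomial_aff:
  assumes a: "\<not> int p dvd a" and m: "m > 1" "m' > 1"
    and period: "\<And>k. int p dvd (\<Sum>i<k. a ^ i) \<longleftrightarrow> m dvd k"
      "\<And>k. int (p\<^sup>2) dvd (\<Sum>i<k. a ^ i) \<longleftrightarrow> m' dvd k"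
    and card0: "card {y \<in> Z. int (p\<^sup>2) dvd (a - 1) * y + u} = n0"
    and card1: "card {y \<in> Z. int p dvd (a - 1) * y + u} = n1"
  shows cycle_monomial_aff_neq: "m \<noteq> m' \<Longrightarrow> cycle_monomial Z (aff a u) =
      var 1 ^ n0 * var m ^ ((n1 - n0) div m) * var m' ^ ((p\<^sup>2 - n1) div m')"
    and cycle_monomial_aff_eq: "m = m' \<Longrightarrow> cycle_monomial Z (aff a u) =
      var 1 ^ n0 * var m ^ ((p\<^sup>2 - n0) div m)"
proof -
  let ?d = "\<lambda>y. (a - 1) * y + u"
  let ?Y0 = "{y \<in> Z. int (p\<^sup>2) dvd ?d y}" and ?Y1 = "{y \<in> Z. int p dvd ?d y}"
  have "coprime a (int p)"
    using a p(1) by (metis coprime_commute prime_imp_coprime prime_nat_int_transfer)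
  then have "coprime a (int (p\<^sup>2))" by simp
  then have perm: "aff a u permutes Z"
    by (rule affine_perm_permutes[OF prime_square_gt_1])
  have orbit: "card (orbit (aff a u) y) =
      (if int (p\<^sup>2) dvd ?d y then 1 else if int p dvd ?d y then m else m')" if "y \<in> Z" for y
    using card_orbit_aff[OF that _ _ period] m by simp
  have dvd: "int p dvd x" if "int (p\<^sup>2) dvd x" for x
    using that by (metis dvd_mult_left of_nat_mult power2_eq_square)
  then have sub: "?Y0 \<subseteq> ?Y1" by blast
  have "card (orbit (aff a u) y) = 1 \<longleftrightarrow> int (p\<^sup>2) dvd ?d y" if "y \<in> Z" for y
    unfolding orbit[OF that] using m by simp
  then have Y0: "{y \<in> Z. card (orbit (aff a u) y) = 1} = ?Y0" by blast
  have Y01: "card (?Y1 - ?Y0) = n1 - n0"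
    using card_Diff_subset[OF finite_Z_Collect sub] by (simp only: card0 card1)
  have YZ: "card (Z - ?Y1) = p\<^sup>2 - n1" "card (Z - ?Y0) = p\<^sup>2 - n0"
    by (simp_all only: card_Z_Diff card0 card1)
  {
    assume neq: "m \<noteq> m'"
    have "card (orbit (aff a u) y) = m \<longleftrightarrow> int p dvd ?d y \<and> \<not> int (p\<^sup>2) dvd ?d y"
      "card (orbit (aff a u) y) = m' \<longleftrightarrow> \<not> int p dvd ?d y" if "y \<in> Z" for y
      unfolding orbit[OF that] using m neq dvd[of "?d y"] by simp_all
    then have "{y \<in> Z. card (orbit (aff a u) y) = m} = ?Y1 - ?Y0"
      "{y \<in> Z. card (orbit (aff a u) y) = m'} = Z - ?Y1" by blast+
    moreover have "cycle_monomial Z (aff a u) =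
        (\<Prod>l\<in>{1, m, m'}. var l ^ (card {y \<in> Z. card (orbit (aff a u) y) = l} div l))"
    proof (rule cycle_monomial_eq[OF _ perm])
      show "card (orbit (aff a u) y) \<in> {1, m, m'}" if "y \<in> Z" for y
        unfolding orbit[OF that] by simp
    qed (use m in auto)
    ultimately show "cycle_monomial Z (aff a u) =
        var 1 ^ n0 * var m ^ ((n1 - n0) div m) * var m' ^ ((p\<^sup>2 - n1) div m')"
      using m neq Y0 Y01 YZ card0 by (simp add: mult.assoc)
  next
    assume eq: "m = m'"
    have "card (orbit (aff a u) y) = m \<longleftrightarrow> \<not> int (p\<^sup>2) dvd ?d y" if "y \<in> Z" for y
      unfolding orbit[OF that] using m eq by simp
    then have "{y \<in> Z. card (orbit (aff a u) y) = m} = Z - ?Y0" by blast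
    moreover have "cycle_monomial Z (aff a u) =
        (\<Prod>l\<in>{1, m}. var l ^ (card {y \<in> Z. card (orbit (aff a u) y) = l} div l))"
    proof (rule cycle_monomial_eq[OF _ perm])
      show "card (orbit (aff a u) y) \<in> {1, m}" if "y \<in> Z" for y
        unfolding orbit[OF that] using eq by simp
    qed (use m in auto)
    ultimately show "cycle_monomial Z (aff a u) = var 1 ^ n0 * var m ^ ((p\<^sup>2 - n0) div m)"
      using m Y0 YZ card0 by simp
  }
qed

lemma cycle_monomial_aff_unipotent:
  assumes a: "[a = 1] (mod int p)"
    and card: "card {y \<in> Z. int (p\<^sup>2) dvd (a - 1) * y + u} = n0"
      "card {y \<in> Z. int p dvd (a - 1) * y + u} = n1"
  shows "cycle_monomial Z (aff a u) =
    var 1 ^ n0 * var p ^ ((n1 - n0) div p) * var (p\<^sup>2) ^ ((p\<^sup>2 - n1) div p\<^sup>2)"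
proof (rule cycle_monomial_aff_neq[OF _ _ _ _ _ card])
  have p1: "p > 1" using p(1) prime_gt_1_nat by blast
  then show "p > 1" "p\<^sup>2 > 1" using prime_square_gt_1 by auto
  show "p \<noteq> p\<^sup>2" using p1 by (simp add: power2_eq_square)
  show "\<not> int p dvd a" using cong_dvd_iff[OF a] p1 by auto
  show "int p dvd (\<Sum>i<k. a ^ i) \<longleftrightarrow> p dvd k" for k
    using prime_power_dvd_geometric_sum_iff[OF p a, of 1 k] by simp
  show "int (p\<^sup>2) dvd (\<Sum>i<k. a ^ i) \<longleftrightarrow> p\<^sup>2 dvd k" for k
    using prime_power_dvd_geometric_sum_iff[OF p a, of 2 k] by simp
qed

text \<open>
  Since \<open>a - 1\<close> is invertible, the displacement \<open>(a - 1) y + u\<close> takes every value once, so there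
  are one fixed point and \<open>p\<close> points with displacement divisible by \<open>p\<close>, independently of \<open>u\<close>.
\<close>

lemma cycle_monomial_aff_nonunipotent:
  assumes a: "a \<in> totatives (p\<^sup>2)" "\<not> [a = 1] (mod p)"
  shows cycle_monomial_aff_ord_eq: "ord (p\<^sup>2) a = ord p a \<Longrightarrow>
      cycle_monomial Z (aff (int a) u) = var 1 * var (ord p a) ^ ((p\<^sup>2 - 1) div ord p a)"
    and cycle_monomial_aff_ord_neq: "ord (p\<^sup>2) a = ord p a * p \<Longrightarrow>
      cycle_monomial Z (aff (int a) u) = var 1 * var (ord p a * p) ^ ((p - 1) div ord p a) *
        var (ord p a) ^ ((p - 1) div ord p a)"
proof -
  let ?t = "ord p a" and ?s = "ord (p\<^sup>2) a"
  have p1: "p > 1" using p(1) prime_gt_1_nat by blast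
  have cop: "coprime p a"
    using a(1) by (auto simp: totatives_def coprime_commute)
  have not_dvd: "\<not> int p dvd int a"
    using cop p1 by (auto simp: coprime_absorb_left)
  have "?t \<noteq> 1" using a(2) ord_eq_Suc_0_iff[of p a] by simp
  moreover have "?t > 0" using cop by simp
  ultimately have t: "?t > 1" by linarith
  have period: "int p dvd (\<Sum>i<k. int a ^ i) \<longleftrightarrow> ?t dvd k"
    "int (p\<^sup>2) dvd (\<Sum>i<k. int a ^ i) \<longleftrightarrow> ?s dvd k" for k
    using prime_power_dvd_geometric_sum_iff_ord[OF p(1) a(2), of 1 k]
      prime_power_dvd_geometric_sum_iff_ord[OF p(1) a(2), of 2 k] by simp_all
  have "\<not> int p dvd int a - 1"
    using a(2) by (metis cong_iff_dvd_diff cong_int_iff of_nat_1)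
  then have cop': "coprime (int a - 1) (int p)"
    using p(1) by (metis coprime_commute prime_imp_coprime prime_nat_int_transfer)
  then have "coprime (int a - 1) (int (p\<^sup>2))" by simp
  then have card0: "card {y \<in> Z. int (p\<^sup>2) dvd (int a - 1) * y + u} = 1"
    using card_linear_dvd[of "int a - 1" "p\<^sup>2" 1 u] p1 by simp
  have card1: "card {y \<in> Z. int p dvd (int a - 1) * y + u} = p"
    using card_linear_dvd[OF cop', of p u] p1 by (simp add: power2_eq_square)
  show "cycle_monomial Z (aff (int a) u) = var 1 * var ?t ^ ((p\<^sup>2 - 1) div ?t)" if s: "?s = ?t"
  proof -
    have "?s > 1" unfolding s by (rule t)
    from cycle_monomial_aff_eq[OF not_dvd t this period card0 card1 s[symmetric]]
    show ?thesis by (simp only: power_one_right)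
  qed
  show "cycle_monomial Z (aff (int a) u) = var 1 * var (?t * p) ^ ((p - 1) div ?t) *
      var ?t ^ ((p - 1) div ?t)" if s: "?s = ?t * p"
  proof -
    have "p\<^sup>2 - p = p * (p - 1)" by (simp add: power2_eq_square diff_mult_distrib2)
    then have "(p\<^sup>2 - p) div (?t * p) = (p - 1) div ?t"
      using p1 by (simp add: mult.commute)
    moreover have neq: "?t \<noteq> ?s" unfolding s using t p1 by simp
    have "?s > 1" unfolding s using t p1 by (rule less_1_mult)
    note cycle_monomial_aff_neq[OF not_dvd t this period card0 card1 neq]
    ultimately show ?thesis by (simp only: s power_one_right mult_ac)
  qed
qed

lemma card_multiples: "card {u \<in> Z. int p dvd u} = p"
  using card_linear_dvd[of 1 p p 0] p(1) by (simp add: power2_eq_square prime_gt_0_nat)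

lemma sum_if_dvd:
  fixes A :: "int \<Rightarrow> 'b :: comm_semiring_1"
  shows "(\<Sum>u\<in>Z. if int p dvd u then A u else B) =
    (\<Sum>u | u \<in> Z \<and> int p dvd u. A u) + of_nat (p * (p - 1)) * B"
proof -
  have "card (Z - {u \<in> Z. int p dvd u}) = p * (p - 1)"
    unfolding card_Z_Diff card_multiples by (simp add: power2_eq_square diff_mult_distrib2)
  moreover have "Z \<inter> - {u. int p dvd u} = Z - {u \<in> Z. int p dvd u}" by blast
  moreover have "Z \<inter> {u. int p dvd u} = {u. u \<in> Z \<and> int p dvd u}" by blast
  ultimately show ?thesis by (simp add: sum.If_cases)
qed

text \<open>
  As \<open>p\<close> divides \<open>a - 1\<close> but not \<open>u\<close>, it divides no displacement, so every point has the maximal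
  period \<open>p\<^sup>2\<close>.
\<close>

lemma cycle_monomial_aff_full_cycle:
  assumes a: "[a = 1] (mod int p)" and u: "\<not> int p dvd u"
  shows "cycle_monomial Z (aff a u) = var (p\<^sup>2)"
proof -
  have "\<not> int p dvd (a - 1) * y + u" for y
    using a u by (metis cong_iff_dvd_diff dvd_add_right_iff dvd_mult2)
  moreover from this have "\<not> int (p\<^sup>2) dvd (a - 1) * y + u" for y
    by (metis dvd_mult_left of_nat_mult power2_eq_square)
  ultimately show ?thesis
    using cycle_monomial_aff_unipotent[OF a, of u 0 0] p(1) by (simp add: prime_gt_0_nat)
qed

lemma sum_cycle_monomial_translations:
  "(\<Sum>u\<in>Z. cycle_monomial Z (aff 1 u)) =
    var 1 ^ p\<^sup>2 + of_nat (p - 1) * var p ^ p + of_nat (p * (p - 1)) * var (p\<^sup>2)"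
proof -
  have p0: "p > 0" using p(1) prime_gt_0_nat by blast
  have monomial: "cycle_monomial Z (aff 1 u) =
      (if int p dvd u then if u = 0 then var 1 ^ p\<^sup>2 else var p ^ p else var (p\<^sup>2))"
    if u: "u \<in> Z" for u
  proof (cases "int p dvd u")
    case True
    have "int (p\<^sup>2) dvd u \<longleftrightarrow> u = 0" using u zdvd_not_zless[of u "int (p\<^sup>2)"] by force
    then have "{y \<in> Z. int (p\<^sup>2) dvd (1 - 1) * y + u} = (if u = 0 then Z else {})" by auto
    then have card0: "card {y \<in> Z. int (p\<^sup>2) dvd (1 - 1) * y + u} = (if u = 0 then p\<^sup>2 else 0)"
      using card_Z by (simp only: if_distrib[of card] card.empty)
    have "{y \<in> Z. int p dvd (1 - 1) * y + u} = Z" using True by auto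
    then have card1: "card {y \<in> Z. int p dvd (1 - 1) * y + u} = p\<^sup>2" by (simp only: card_Z)
    have "p\<^sup>2 div p = p" using p0 by (simp add: power2_eq_square)
    then show ?thesis
      using cycle_monomial_aff_unipotent[OF cong_refl card0 card1] True by simp
  next
    case False
    then show ?thesis using cycle_monomial_aff_full_cycle[of 1 u] by simp
  qed
  let ?P = "{u. u \<in> Z \<and> int p dvd u}"
  have P: "finite ?P" "0 \<in> ?P" using p0 by (auto intro: finite_subset[of _ Z])
  have "(\<Sum>u\<in>?P. if u = 0 then var 1 ^ p\<^sup>2 else var p ^ p) =
      var 1 ^ p\<^sup>2 + (\<Sum>u\<in>?P - {0}. var p ^ p)"
    using P by (subst sum.remove[of _ 0]) (auto intro!: sum.cong)
  also have "(\<Sum>u\<in>?P - {0}. var p ^ p) = of_nat (p - 1) * var p ^ p"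
    using P card_multiples by simp
  finally have multiples: "(\<Sum>u\<in>?P. if u = 0 then var 1 ^ p\<^sup>2 else var p ^ p) =
      var 1 ^ p\<^sup>2 + of_nat (p - 1) * var p ^ p" .
  have "(\<Sum>u\<in>Z. cycle_monomial Z (aff 1 u)) = (\<Sum>u\<in>Z.
      if int p dvd u then if u = 0 then var 1 ^ p\<^sup>2 else var p ^ p else var (p\<^sup>2))"
    by (rule sum.cong[OF refl monomial])
  then show ?thesis by (simp only: sum_if_dvd multiples)
qed

text \<open>
  Write \<open>a = 1 + p c\<close> with \<open>c\<close> prime to \<open>p\<close>. For \<open>u = p v\<close> the displacement is \<open>p (c y + v)\<close>,
  always divisible by \<open>p\<close>, and divisible by \<open>p\<^sup>2\<close> for exactly \<open>p\<close> values of \<open>y\<close>.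
\<close>

lemma sum_cycle_monomial_ord_p:
  assumes a: "[a = 1] (mod int p)" "\<not> [a = 1] (mod int (p\<^sup>2))"
  shows "(\<Sum>u\<in>Z. cycle_monomial Z (aff a u)) =
    of_nat p * (var 1 ^ p * var p ^ (p - 1)) + of_nat (p * (p - 1)) * var (p\<^sup>2)"
proof -
  have p0: "p > 0" using p(1) prime_gt_0_nat by blast
  obtain c where c: "a - 1 = int p * c"
    using a(1) by (auto simp: cong_iff_dvd_diff)
  have "\<not> int p dvd c"
    using a(2) c by (auto simp: cong_iff_dvd_diff power2_eq_square)
  then have cop: "coprime c (int p)"
    using p(1) by (metis coprime_commute prime_imp_coprime prime_nat_int_transfer)
  have monomial: "cycle_monomial Z (aff a u) =
      (if int p dvd u then var 1 ^ p * var p ^ (p - 1) else var (p\<^sup>2))" for u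
  proof (cases "int p dvd u")
    case True
    then obtain v where v: "u = int p * v" by blast
    have d: "(a - 1) * y + u = int p * (c * y + v)" for y
      by (simp add: c v algebra_simps)
    have "card {y \<in> Z. int (p\<^sup>2) dvd (a - 1) * y + u} = p"
      unfolding d using card_linear_dvd[OF cop p0, of p v] p0 by (simp add: power2_eq_square)
    moreover have "card {y \<in> Z. int p dvd (a - 1) * y + u} = p\<^sup>2"
      unfolding d using card_Z by (simp only: dvd_triv_left simp_thms Collect_mem_eq)
    moreover have "(p\<^sup>2 - p) div p = p - 1"
      using p0 by (simp add: power2_eq_square diff_mult_distrib2[symmetric, of p p 1, simplified])
    ultimately show ?thesis
      using cycle_monomial_aff_unipotent[OF a(1)] True by simp
  next
    case False
    then show ?thesis using cycle_monomial_aff_full_cycle[OF a(1)] by simp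
  qed
  have "(\<Sum>u | u \<in> Z \<and> int p dvd u. var 1 ^ p * var p ^ (p - 1)) =
      of_nat p * (var 1 ^ p * var p ^ (p - 1))"
    using card_multiples by simp
  then show ?thesis unfolding monomial sum_if_dvd by (rule arg_cong)
qed

end

theorem proposition3p3:
  fixes p :: nat
  assumes "prime p" and "odd p"
  shows "cycle_index (carrier (residue_ring (int (p\<^sup>2)))) (Aff1 (residue_ring (int (p\<^sup>2)))) =
    const (1 / of_nat (p\<^sup>2 * totient (p\<^sup>2))) *
      (var 1 ^ (p\<^sup>2)
       + of_nat (p - 1) * var p ^ p
       + of_nat (p\<^sup>2) * (\<Sum>t\<in>{t. t dvd p - 1 \<and> t \<noteq> 1}.
           of_nat (totient t) * var 1 * var t ^ ((p\<^sup>2 - 1) div t))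
       + of_nat (p\<^sup>2) * (\<Sum>t\<in>{t. t dvd p - 1 \<and> t \<noteq> 1}.
           of_nat (totient (t * p)) * var 1 * var (t * p) ^ ((p - 1) div t) * var t ^ ((p - 1) div t))
       + of_nat (p * (p - 1)) * var 1 ^ p * var p ^ (p - 1)
       + of_nat (p * totient (p\<^sup>2)) * var (p\<^sup>2))"
proof -
  \<comment> \<open>\<open>H1 t\<close> and \<open>H2 t\<close> are the sums of the monomials over all translation parts, for a
    multiplier of order \<open>t\<close> and \<open>t p\<close> respectively.\<close>
  define H1 where "H1 t = (if t = 1
    then var 1 ^ p\<^sup>2 + of_nat (p - 1) * var p ^ p + of_nat (p * (p - 1)) * var (p\<^sup>2)
    else of_nat (p\<^sup>2) * (var 1 * var t ^ ((p\<^sup>2 - 1) div t)))" for t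
  define H2 where "H2 t = (if t = 1
    then of_nat p * (var 1 ^ p * var p ^ (p - 1)) + of_nat (p * (p - 1)) * var (p\<^sup>2)
    else of_nat (p\<^sup>2) *
      (var 1 * var (t * p) ^ ((p - 1) div t) * var t ^ ((p - 1) div t)))" for t
  let ?R = "residue_ring (int (p\<^sup>2))" and ?Z = "{0..<int (p\<^sup>2)}"
  let ?T = "{t. t dvd p - 1 \<and> t \<noteq> 1}"
  have p1: "p > 1" using assms(1) prime_gt_1_nat by blast
  have q1: "p\<^sup>2 > 1" using p1 by (intro one_less_power) auto
  have carrier: "carrier ?R = ?Z" by (auto simp: residue_ring_def)
  have "card (Aff1 ?R) = (\<Sum>f\<in>Aff1 ?R. 1)" by simp
  also have "\<dots> = p\<^sup>2 * totient (p\<^sup>2)"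
    using sum_Aff1_residue_ring[OF q1, of "\<lambda>_. 1::nat"]
    by (simp add: totient_def mult.commute del: of_nat_power)
  finally have card: "card (Aff1 ?R) = p\<^sup>2 * totient (p\<^sup>2)" .
  have "(\<Sum>f\<in>Aff1 ?R. cycle_monomial ?Z f) =
      (\<Sum>a\<in>totatives (p\<^sup>2). \<Sum>u\<in>?Z. cycle_monomial ?Z (affine_perm ?R (int a) u))"
    by (rule sum_Aff1_residue_ring[OF q1])
  also have "\<dots> = (\<Sum>t | t dvd p - 1. of_nat (totient t) * H1 t) +
      (\<Sum>t | t dvd p - 1. of_nat (totient (t * p)) * H2 t)"
  proof (rule sum_totatives_prime_square[OF assms])
    fix a t assume a: "a \<in> totatives (p\<^sup>2)" and t: "t dvd p - 1" and ord: "ord (p\<^sup>2) a = t"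
    have ord_p: "ord p a = t"
      using ord_prime_eq_of_ord_prime_square[OF assms(1) t] ord by blast
    show "(\<Sum>u\<in>?Z. cycle_monomial ?Z (affine_perm ?R (int a) u)) = H1 t"
    proof (cases "t = 1")
      case True
      then have "[a = 1] (mod p\<^sup>2)" using ord by (simp add: ord_eq_Suc_0_iff)
      then have "a = 1" using totatives_less[OF a q1] q1 by (metis cong_less_modulus_unique_nat)
      then show ?thesis
        using True sum_cycle_monomial_translations[OF assms] by (simp add: H1_def)
    next
      case False
      then have "\<not> [a = 1] (mod p)" using ord_p ord_eq_Suc_0_iff[of p a] by simp
      then show ?thesis
        using cycle_monomial_aff_ord_eq[OF assms a] ord ord_p False by (simp add: H1_def)
    qed
  next
    fix a t assume a: "a \<in> totatives (p\<^sup>2)" and t: "t dvd p - 1" and ord: "ord (p\<^sup>2) a = t * p"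
    have ord_p: "ord p a = t"
      using ord_prime_eq_of_ord_prime_square[OF assms(1) t] ord by blast
    show "(\<Sum>u\<in>?Z. cycle_monomial ?Z (affine_perm ?R (int a) u)) = H2 t"
    proof (cases "t = 1")
      case True
      then have "[a = 1] (mod p)" "\<not> [a = 1] (mod p\<^sup>2)"
        using ord ord_p p1 ord_eq_Suc_0_iff[of p a] ord_eq_Suc_0_iff[of "p\<^sup>2" a] by simp_all
      then have "[int a = 1] (mod int p)" "\<not> [int a = 1] (mod int (p\<^sup>2))"
        by (metis cong_int_iff of_nat_1)+
      then show ?thesis
        using True sum_cycle_monomial_ord_p[OF assms] by (simp add: H2_def)
    next
      case False
      then have "\<not> [a = 1] (mod p)" using ord_p ord_eq_Suc_0_iff[of p a] by simp
      then show ?thesis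
        using cycle_monomial_aff_ord_neq[OF assms a] ord ord_p False by (simp add: H2_def)
    qed
  qed
  also have "(\<Sum>t | t dvd p - 1. of_nat (totient t) * H1 t) =
      H1 1 + (\<Sum>t\<in>?T. of_nat (totient t) * H1 t)"
    using p1 by (subst sum.remove[of _ 1]) (auto intro!: sum.cong)
  also have "(\<Sum>t | t dvd p - 1. of_nat (totient (t * p)) * H2 t) =
      of_nat (p - 1) * H2 1 + (\<Sum>t\<in>?T. of_nat (totient (t * p)) * H2 t)"
    using p1 assms(1) by (subst sum.remove[of _ 1]) (auto intro!: sum.cong simp: totient_prime)
  also have "(\<Sum>t\<in>?T. of_nat (totient t) * H1 t) = of_nat (p\<^sup>2) * (\<Sum>t\<in>?T.
      of_nat (totient t) * var 1 * var t ^ ((p\<^sup>2 - 1) div t))"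
    unfolding sum_distrib_left by (intro sum.cong refl) (simp add: H1_def mult_ac)
  also have "(\<Sum>t\<in>?T. of_nat (totient (t * p)) * H2 t) = of_nat (p\<^sup>2) * (\<Sum>t\<in>?T.
      of_nat (totient (t * p)) * var 1 * var (t * p) ^ ((p - 1) div t) * var t ^ ((p - 1) div t))"
    unfolding sum_distrib_left by (intro sum.cong refl) (simp add: H2_def mult_ac)
  finally have sum: "(\<Sum>f\<in>Aff1 ?R. cycle_monomial ?Z f) =
      H1 1 + of_nat (p\<^sup>2) * (\<Sum>t\<in>?T.
        of_nat (totient t) * var 1 * var t ^ ((p\<^sup>2 - 1) div t)) +
      (of_nat (p - 1) * H2 1 + of_nat (p\<^sup>2) * (\<Sum>t\<in>?T.
        of_nat (totient (t * p)) * var 1 * var (t * p) ^ ((p - 1) div t) *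
          var t ^ ((p - 1) div t)))" .
  have "totient (p\<^sup>2) = p * (p - 1)"
    using totient_prime_power[of p 2] assms(1) by (simp add: mult.commute)
  \<comment> \<open>The maximal cycles come from the translations and from the \<open>p - 1\<close> multipliers of order \<open>p\<close>.\<close>
  then have "p * totient (p\<^sup>2) = p * (p - 1) + (p - 1) * (p * (p - 1))"
    using p1 by (cases p) simp_all
  then have full_cycles: "of_nat (p * totient (p\<^sup>2)) * var (p\<^sup>2) =
      of_nat (p * (p - 1)) * var (p\<^sup>2) + of_nat (p - 1) * (of_nat (p * (p - 1)) * var (p\<^sup>2))"
    by (simp only: of_nat_add of_nat_mult distrib_right mult.assoc)
  have ord_p: "of_nat (p * (p - 1)) * var 1 ^ p * var p ^ (p - 1) =
      of_nat (p - 1) * (of_nat p * (var 1 ^ p * var p ^ (p - 1)))"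
    by (simp only: of_nat_mult mult_ac)
  show ?thesis
    unfolding cycle_index_def carrier cycle_monomial_def[symmetric] card sum H1_def H2_def
      full_cycles ord_p
    by (simp only: simp_thms if_True distrib_left add_ac)
qed

end
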